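(* Let $\boldsymbol{\pi}$ be the closed-loop RNN system described in the context with HZ state domain $\mathcal{X}\subset\mathbb{R}^n$, and let $T>1$. Suppose that an initial state set $\mathcal{X}_1\subset\mathcal{X}$ and an unsafe set $\mathcal{O}\subset\mathcal{X}$ are both hybrid zonotopes (HZs), with $\mathcal{X}_1\cap\mathcal{O}=\emptyset$. Let $\{\tilde{\mathcal{R}}_t(\mathcal{X}_1)\}_{t=2}^T$ and $\{\tilde{\mathcal{P}}_t(\mathcal{O})\}_{t=2}^T$ be the approximated forward and backward reachable sets $$\tilde{\mathcal{R}}_t(\mathcal{X}_1)=[\mathbf{0}_{n\times n}\;\;\boldsymbol{I}_n]\cdot\big(\tilde{\mathcal{S}}^{N_b}_{x,t}\cap_{[\boldsymbol{I}_n\;\mathbf{0}_{n\times n}]}\mathcal{X}_1\big),\qquad \tilde{\mathcal{P}}_t(\mathcal{O})=[\boldsymbol{I}_n\;\;\mathbf{0}_{n\times n}]\cdot\big(\tilde{\mathcal{S}}^{N_b}_{x,t}\cap_{[\mathbf{0}_{n\times n}\;\boldsymbol{I}_n]}\mathcal{O}\big),$$ where $\{\tilde{\mathcal{S}}^{N_b}_{x,t}\}_{t=2}^T$ is the output over the domain $\mathcal{X}$ of the relaxed algorithm described in the context with binary limit parameter $N_b\in\mathbb{Z}_{\ge0}$. Then all trajectories of the closed-loop RNN system starting from $\mathcal{X}_1$ avoid the unsafe region $\mathcal{O}$ within $T$ steps (i.e. $x_t\notin\mathcal{O}$ for all $t\in\{1,\dots,T\}$ whenever $x_1\in\mathcal{X}_1$),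 if either: (i) for $t=2,\dots,T$, $\tilde{\mathcal{R}}_t(\mathcal{X}_1)\cap\mathcal{O}=\emptyset$; or (ii) for $t=2,\dots,T$, $\tilde{\mathcal{P}}_t(\mathcal{O})\cap\mathcal{X}_1=\emptyset$.
   Context: **Hybrid zonotopes.** A set $\mathcal{Z}\subset\mathbb{R}^n$ is a hybrid zonotope (HZ) if there are $\mathbf{c}\in\mathbb{R}^n$, $\mathbf{G}^c\in\mathbb{R}^{n\times n_g}$, $\mathbf{G}^b\in\mathbb{R}^{n\times n_b}$, $\mathbf{A}^c\in\mathbb{R}^{n_c\times n_g}$, $\mathbf{A}^b\in\mathbb{R}^{n_c\times n_b}$, $\mathbf{b}\in\mathbb{R}^{n_c}$ with $\mathcal{Z}=\{\mathbf{G}^c\xi^c+\mathbf{G}^b\xi^b+\mathbf{c}\mid \|\xi^c\|_\infty\le1,\ \xi^b\in\{-1,1\}^{n_b},\ \mathbf{A}^c\xi^c+\mathbf{A}^b\xi^b=\mathbf{b}\}$; write $\mathcal{Z}=\langle\mathbf{G}^c,\mathbf{G}^b,\mathbf{c},\mathbf{A}^c,\mathbf{A}^b,\mathbf{b}\rangle$ (numbers of generators or constraints may be $0$). The algorithm operates on such representations. Operations: - Affine map: $R\mathcal{Z}+v=\langle R\mathbf{G}^c,R\mathbf{G}^b,R\mathbf{c}+v,\mathbf{A}^c,\mathbf{A}^b,\mathbf{b}\rangle$. Cartesian products use block-diagonal matrices. - Generalized intersection: $\mathcal{Z}\cap_R\mathcal{Y}=\{z\in\mathcal{Z}\mid Rz\in\mathcal{Y}\}$,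 represented by $$\left\langle[\mathbf{0}\ \mathbf{G}_z^c],[\mathbf{0}\ \mathbf{G}_z^b],\mathbf{c}_z,\begin{bmatrix}\mathbf{A}_y^c&\mathbf{0}\\\mathbf{0}&\mathbf{A}_z^c\\-\mathbf{G}_y^c&R\mathbf{G}_z^c\end{bmatrix},\begin{bmatrix}\mathbf{A}_y^b&\mathbf{0}\\\mathbf{0}&\mathbf{A}_z^b\\-\mathbf{G}_y^b&R\mathbf{G}_z^b\end{bmatrix},\begin{bmatrix}\mathbf{b}_y\\\mathbf{b}_z\\\mathbf{c}_y-R\mathbf{c}_z\end{bmatrix}\right\rangle.$$ - Constrained product: if $\mathbf{A}^c_y=\begin{bmatrix}\mathbf{A}^c_z\ \ \mathbf{0}\\\bar{\mathbf{A}}^c_y\end{bmatrix}$, $\mathbf{A}^b_y=\begin{bmatrix}\mathbf{A}^b_z\ \ \mathbf{0}\\\bar{\mathbf{A}}^b_y\end{bmatrix}$, $\mathbf{b}_y=\begin{bmatrix}\mathbf{b}_z\\\bar{\mathbf{b}}_y\end{bmatrix}$ (top block rows $[\mathbf{A}_z\ \mathbf{0}]$), then $$\mathcal{C}(\mathcal{Z},\mathcal{Y})=\left\langle\begin{bmatrix}\mathbf{G}^c_z\ \ \mathbf{0}\\\mathbf{G}^c_y\end{bmatrix},\begin{bmatrix}\mathbf{G}^b_z\ \ \mathbf{0}\\\mathbf{G}^b_y\end{bmatrix},\begin{bmatrix}\mathbf{c}_z\\\mathbf{c}_y\end{bmatrix},\mathbf{A}^c_y,\mathbf{A}^b_y,\mathbf{b}_y\right\rangle.$$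 **Closed-loop RNN.** $\boldsymbol{\pi}$ has $L$ hidden layers with weights $W_h^{(\ell)}\in\mathbb{R}^{n_\ell\times n_\ell}$, $W_x^{(\ell)}\in\mathbb{R}^{n_\ell\times n_{\ell-1}}$, $v_h^{(\ell)}\in\mathbb{R}^{n_\ell}$ ($\ell\in[L]=\{1,\dots,L\}$, $n_0=n$), output weights $W_y\in\mathbb{R}^{n\times n_L}$, $v_y\in\mathbb{R}^n$, and $\sigma$ the componentwise ReLU. From $x_1\in\mathcal{X}$ and zero initial hidden states $h_0^{(\ell)}=0$: $h_t^{(0)}=x_t$, $h_t^{(\ell)}=\sigma(W_h^{(\ell)}h_{t-1}^{(\ell)}+W_x^{(\ell)}h_t^{(\ell-1)}+v_h^{(\ell)})$ for $\ell\in[L]$, and $x_{t+1}=\sigma(W_yh_t^{(L)}+v_y)$. This is abbreviated $x_{t+1}=\boldsymbol{\pi}(x_t)$ (hidden states are carried along); $\mathcal{X}$ is the state domain. The trajectory starting from $x_1$ is the resulting sequence $(x_1,x_2,\dots)$. **ReLU graph and relaxation.** For an interval $[\alpha,\beta]$, $\mathcal{G}_{ReLU}([\alpha,\beta])$ denotes an HZ exactly representing $\{(s,\max(s,0))\mid s\in[\alpha,\beta]\}$: a segment with one continuous generator if $\alpha\ge0$ or $\beta\le0$ (a stable unit), and a fixed HZ $\mathcal{H}_\pm=\langle\mathbf{G}^c_\pm,\mathbf{G}^b_\pm,\mathbf{c}_\pm,\mathbf{A}^c_\pm,\mathbf{A}^b_\pm,\mathbf{b}_\pm\rangle$ with one binary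 generator if $\alpha<0<\beta$ (an unstable unit). The triangle relaxation is $\mathcal{H}_\triangle=\langle[\mathbf{G}^c_\pm\ \mathbf{G}^b_\pm],\emptyset,\mathbf{c}_\pm,[\mathbf{A}^c_\pm\ \mathbf{A}^b_\pm],\emptyset,\mathbf{b}_\pm\rangle\supset\mathcal{H}_\pm$, which equals the convex hull of the graph (a triangle of area $-\alpha\beta/2$). For a label in $\{0,1\}$, $\tilde{\mathcal{G}}_{ReLU}([\alpha,\beta],\text{label})=\mathcal{H}_\triangle$ if $\alpha<0<\beta$ and label $=1$, and $=\mathcal{G}_{ReLU}([\alpha,\beta])$ otherwise. For boxes with label vectors, take Cartesian products over coordinates; $P$ is the permutation matrix listing all input coordinates first, then all output coordinates. **Relaxed algorithm.** Input: HZ $\mathcal{X}$, the RNN, $T>1$, $N_b\in\mathbb{Z}_{\ge0}$. First compute sound boxes $\mathcal{I}_{h,t}^{(\ell)}$, $\mathcal{I}_{y,t}$ ($t\in[T-1]$, $\ell\in[L]$) containing, for every $x_1\in\mathcal{X}$, the pre-activations $W_h^{(\ell)}h_{t-1}^{(\ell)}+W_x^{(\ell)}h_t^{(\ell-1)}+v_h^{(\ell)}$ and $W_yh_t^{(L)}+v_y$ respectively. Rank all unstable ReLU units across all layers and all time steps $t\in[T-1]$ in descending order of the score $-\alpha\beta/2$ ($[\alpha,\beta]$ the unit's input interval); give label $0$ to the top $N_b$ units and label $1$ to the remaining unstable ones. Set $\tilde{\mathcal{H}}_1^{(0)}=\mathcal{X}$. For $t=1,\dots,T-1$: for $\ell=1,\dots,L$: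 let $\tilde{\mathcal{Z}}=W_x^{(\ell)}\tilde{\mathcal{H}}_1^{(\ell-1)}+v_h^{(\ell)}$ if $t=1$, and $\tilde{\mathcal{Z}}=[W_h^{(\ell)}\ W_x^{(\ell)}]\,\mathcal{C}(\tilde{\mathcal{H}}_{t-1}^{(\ell)},\tilde{\mathcal{H}}_t^{(\ell-1)})+v_h^{(\ell)}$ if $t\ge2$; set $\tilde{\mathcal{H}}_t^{(\ell)}=[\mathbf{0}\ \boldsymbol{I}]\big((P\,\tilde{\mathcal{G}}_{ReLU}(\mathcal{I}_{h,t}^{(\ell)},\text{label}_{h,t}^{(\ell)}))\cap_{[\boldsymbol{I}\ \mathbf{0}]}\tilde{\mathcal{Z}}\big)$. Then with $\tilde{\mathcal{Z}}_y=W_y\tilde{\mathcal{H}}_t^{(L)}+v_y$ set $\tilde{\mathcal{H}}_{t+1}^{(0)}=[\mathbf{0}\ \boldsymbol{I}]\big((P\,\tilde{\mathcal{G}}_{ReLU}(\mathcal{I}_{y,t},\text{label}_{y,t}))\cap_{[\boldsymbol{I}\ \mathbf{0}]}\tilde{\mathcal{Z}}_y\big)$ and $\tilde{\mathcal{S}}_{x,t+1}^{N_b}=\mathcal{C}(\tilde{\mathcal{H}}_1^{(0)},\tilde{\mathcal{H}}_{t+1}^{(0)})$. Output: $\{\tilde{\mathcal{S}}_{x,t}^{N_b}\}_{t=2}^T$. *)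

theory Defs
  imports "HOL-Analysis.Convex" "Jordan_Normal_Form.Matrix"
begin

section \<open>Hybrid zonotopes\<close>

datatype hz = HZ (Gc: "real mat") (Gb: "real mat") (cen: "real vec")
                 (Ac: "real mat") (Ab: "real mat") (rhs: "real vec")

abbreviation ng :: "hz \<Rightarrow> nat" where "ng Z \<equiv> dim_col (Gc Z)"
abbreviation nb :: "hz \<Rightarrow> nat" where "nb Z \<equiv> dim_col (Gb Z)"
abbreviation nc :: "hz \<Rightarrow> nat" where "nc Z \<equiv> dim_vec (rhs Z)"

definition is_hz :: "nat \<Rightarrow> hz \<Rightarrow> bool" where
  "is_hz n Z \<longleftrightarrow>
     cen Z \<in> carrier_vec n \<and> Gc Z \<in> carrier_mat n (ng Z) \<and> Gb Z \<in> carrier_mat n (nb Z) \<and>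
     Ac Z \<in> carrier_mat (nc Z) (ng Z) \<and> Ab Z \<in> carrier_mat (nc Z) (nb Z)"

definition hz_set :: "hz \<Rightarrow> real vec set" where
  "hz_set Z = {Gc Z *\<^sub>v \<xi>c + Gb Z *\<^sub>v \<xi>b + cen Z | \<xi>c \<xi>b.
     \<xi>c \<in> carrier_vec (ng Z) \<and> (\<forall>i<ng Z. \<bar>\<xi>c $ i\<bar> \<le> 1) \<and>
     \<xi>b \<in> carrier_vec (nb Z) \<and> (\<forall>i<nb Z. \<xi>b $ i \<in> {-1, 1}) \<and>
     Ac Z *\<^sub>v \<xi>c + Ab Z *\<^sub>v \<xi>b = rhs Z}"

definition append_cols :: "real mat \<Rightarrow> real mat \<Rightarrow> real mat" (infixr \<open>@\<^sub>c\<close> 66) where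
  "A @\<^sub>c B = four_block_mat A B (0\<^sub>m 0 (dim_col A)) (0\<^sub>m 0 (dim_col B))"

abbreviation block_diag :: "real mat \<Rightarrow> real mat \<Rightarrow> real mat" where
  "block_diag A B \<equiv>
     four_block_mat A (0\<^sub>m (dim_row A) (dim_col B)) (0\<^sub>m (dim_row B) (dim_col A)) B"

definition hz_affine :: "real mat \<Rightarrow> real vec \<Rightarrow> hz \<Rightarrow> hz" where
  "hz_affine R v Z = HZ (R * Gc Z) (R * Gb Z) (R *\<^sub>v cen Z + v) (Ac Z) (Ab Z) (rhs Z)"

definition hz_linear :: "real mat \<Rightarrow> hz \<Rightarrow> hz" where
  "hz_linear R Z = hz_affine R (0\<^sub>v (dim_row R)) Z"

definition hz_prod :: "hz list \<Rightarrow> hz" where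
  "hz_prod Zs =
     HZ (diag_block_mat (map Gc Zs)) (diag_block_mat (map Gb Zs)) (foldr (@\<^sub>v) (map cen Zs) (0\<^sub>v 0))
        (diag_block_mat (map Ac Zs)) (diag_block_mat (map Ab Zs)) (foldr (@\<^sub>v) (map rhs Zs) (0\<^sub>v 0))"

text \<open>The intersection of \<open>Z\<close> with the preimage of \<open>Y\<close> under \<open>R\<close>. The generators and constraints of
  \<open>Y\<close> come first; the constrained products taken below depend on this order.\<close>

definition hz_inter :: "real mat \<Rightarrow> hz \<Rightarrow> hz \<Rightarrow> hz" where
  "hz_inter R Z Y =
     HZ (0\<^sub>m (dim_row (Gc Z)) (ng Y) @\<^sub>c Gc Z)
        (0\<^sub>m (dim_row (Gb Z)) (nb Y) @\<^sub>c Gb Z)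
        (cen Z)
        (block_diag (Ac Y) (Ac Z) @\<^sub>r (- Gc Y @\<^sub>c R * Gc Z))
        (block_diag (Ab Y) (Ab Z) @\<^sub>r (- Gb Y @\<^sub>c R * Gb Z))
        (rhs Y @\<^sub>v rhs Z @\<^sub>v (cen Y - R *\<^sub>v cen Z))"

text \<open>Meaningful only if the constraints of \<open>Z\<close>, padded with zero columns, are the top rows of those
  of \<open>Y\<close>, so that \<open>Z\<close> and \<open>Y\<close> share the leading factors. For the sets computed below this always
  holds, since each is obtained from its predecessor by affine maps, constrained products and
  \<open>hz_inter\<close> with the predecessor as second operand.\<close>

definition constrained_prod :: "hz \<Rightarrow> hz \<Rightarrow> hz" where
  "constrained_prod Z Y =
     HZ ((Gc Z @\<^sub>c 0\<^sub>m (dim_row (Gc Z)) (ng Y - ng Z)) @\<^sub>r Gc Y)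
        ((Gb Z @\<^sub>c 0\<^sub>m (dim_row (Gb Z)) (nb Y - nb Z)) @\<^sub>r Gb Y)
        (cen Z @\<^sub>v cen Y) (Ac Y) (Ab Y) (rhs Y)"

definition proj_fst :: "nat \<Rightarrow> real mat" where
  "proj_fst m = 1\<^sub>m m @\<^sub>c 0\<^sub>m m m"

definition proj_snd :: "nat \<Rightarrow> real mat" where
  "proj_snd m = 0\<^sub>m m m @\<^sub>c 1\<^sub>m m"

section \<open>Closed-loop ReLU recurrent networks\<close>

text \<open>Layers are numbered from 1 to \<open>depth\<close>; \<open>width \<pi> 0\<close> is the state dimension.\<close>

record rnn =
  depth :: nat
  width :: "nat \<Rightarrow> nat"
  Wh :: "nat \<Rightarrow> real mat"
  Wx :: "nat \<Rightarrow> real mat"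
  vh :: "nat \<Rightarrow> real vec"
  Wy :: "real mat"
  vy :: "real vec"

definition is_rnn :: "nat \<Rightarrow> rnn \<Rightarrow> bool" where
  "is_rnn n \<pi> \<longleftrightarrow> width \<pi> 0 = n \<and>
     (\<forall>l\<in>{1..depth \<pi>}.
        Wh \<pi> l \<in> carrier_mat (width \<pi> l) (width \<pi> l) \<and>
        Wx \<pi> l \<in> carrier_mat (width \<pi> l) (width \<pi> (l - 1)) \<and>
        vh \<pi> l \<in> carrier_vec (width \<pi> l)) \<and>
     Wy \<pi> \<in> carrier_mat n (width \<pi> (depth \<pi>)) \<and> vy \<pi> \<in> carrier_vec n"

definition relu :: "real vec \<Rightarrow> real vec" where
  "relu = map_vec (\<lambda>s. max s 0)"

text \<open>\<open>activation \<pi> x\<^sub>1 t l\<close> is the activation of layer \<open>l\<close> at time \<open>t\<close>. Time 0 holds the zero initial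
  hidden states, and layer 0 at time \<open>t \<ge> 1\<close> is the state \<open>x\<^sub>t\<close>.\<close>

fun activation :: "rnn \<Rightarrow> real vec \<Rightarrow> nat \<Rightarrow> nat \<Rightarrow> real vec" where
  "activation \<pi> x1 0 l = 0\<^sub>v (width \<pi> l)"
| "activation \<pi> x1 (Suc 0) 0 = x1"
| "activation \<pi> x1 (Suc (Suc t)) 0 =
     relu (Wy \<pi> *\<^sub>v activation \<pi> x1 (Suc t) (depth \<pi>) + vy \<pi>)"
| "activation \<pi> x1 (Suc t) (Suc l) =
     relu (Wh \<pi> (Suc l) *\<^sub>v activation \<pi> x1 t (Suc l)
           + Wx \<pi> (Suc l) *\<^sub>v activation \<pi> x1 (Suc t) l + vh \<pi> (Suc l))"

definition trajectory :: "rnn \<Rightarrow> real vec \<Rightarrow> nat \<Rightarrow> real vec" where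
  "trajectory \<pi> x1 t = activation \<pi> x1 t 0"

section \<open>ReLU graphs and their relaxation\<close>

definition relu_graph :: "real \<Rightarrow> real \<Rightarrow> (real \<times> real) set" where
  "relu_graph \<alpha> \<beta> = {(s, max s 0) | s. s \<in> {\<alpha>..\<beta>}}"

definition vec_of_pair :: "real \<times> real \<Rightarrow> real vec" where
  "vec_of_pair p = vec_of_list [fst p, snd p]"

definition relax_binaries :: "hz \<Rightarrow> hz" where
  "relax_binaries Z =
     HZ (Gc Z @\<^sub>c Gb Z) (0\<^sub>m (dim_row (Gc Z)) 0) (cen Z) (Ac Z @\<^sub>c Ab Z) (0\<^sub>m (dim_row (Ac Z)) 0) (rhs Z)"

abbreviation unstable :: "real \<Rightarrow> real \<Rightarrow> bool" where
  "unstable \<alpha> \<beta> \<equiv> \<alpha> < 0 \<and> 0 < \<beta>"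

text \<open>Representations of ReLU graphs are not unique; any fixed choice of the following kind is
  admitted. With \<open>s = (1 + \<xi>\<^sub>1) / 2\<close>, \<open>u = (1 + \<xi>\<^sub>2) / 2\<close> and one binary factor \<open>\<xi>\<^sub>b\<close>, the points
  \<open>(\<alpha> s + \<beta> u, \<beta> u)\<close> subject to \<open>\<xi>\<^sub>1 + \<xi>\<^sub>3 + \<xi>\<^sub>b = -1\<close> and \<open>\<xi>\<^sub>2 + \<xi>\<^sub>4 - \<xi>\<^sub>b = -1\<close> are an instance for an
  unstable unit.\<close>

definition relu_graph_rep :: "(real \<Rightarrow> real \<Rightarrow> hz) \<Rightarrow> bool" where
  "relu_graph_rep G \<longleftrightarrow> (\<forall>\<alpha> \<beta>. \<alpha> \<le> \<beta> \<longrightarrow>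
     is_hz 2 (G \<alpha> \<beta>) \<and>
     hz_set (G \<alpha> \<beta>) = vec_of_pair ` relu_graph \<alpha> \<beta> \<and>
     (if unstable \<alpha> \<beta>
      then nb (G \<alpha> \<beta>) = 1 \<and>
           hz_set (relax_binaries (G \<alpha> \<beta>)) = vec_of_pair ` (convex hull relu_graph \<alpha> \<beta>)
      else ng (G \<alpha> \<beta>) = 1 \<and> nb (G \<alpha> \<beta>) = 0 \<and> nc (G \<alpha> \<beta>) = 0))"

definition relaxed_relu :: "(real \<Rightarrow> real \<Rightarrow> hz) \<Rightarrow> real \<Rightarrow> real \<Rightarrow> nat \<Rightarrow> hz" where
  "relaxed_relu G \<alpha> \<beta> lab =
     (if unstable \<alpha> \<beta> \<and> lab = 1 then relax_binaries (G \<alpha> \<beta>) else G \<alpha> \<beta>)"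

text \<open>The product over coordinates is ordered input, output, input, output, \<dots>; this matrix moves all
  \<open>m\<close> inputs to the front.\<close>

definition in_out_perm :: "nat \<Rightarrow> real mat" where
  "in_out_perm m = mat (2 * m) (2 * m)
     (\<lambda>(i, j). if j = (if i < m then 2 * i else 2 * (i - m) + 1) then 1 else 0)"

section \<open>The relaxed algorithm\<close>

text \<open>A unit is a ReLU at a given time: \<open>Hidden t l i\<close> and \<open>Output t i\<close> are the \<open>i\<close>-th ReLU (counted
  from 0) of hidden layer \<open>l\<close> and of the output layer at time \<open>t\<close>. A family of boxes is given by its
  lower and upper bounds per unit.\<close>

datatype relu_unit = Hidden nat nat nat | Output nat nat

definition units :: "rnn \<Rightarrow> nat \<Rightarrow> relu_unit set" where
  "units \<pi> T =
     {Hidden t l i | t l i. t \<in> {1..T - 1} \<and> l \<in> {1..depth \<pi>} \<and> i < width \<pi> l} \<union>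
     {Output t i | t i. t \<in> {1..T - 1} \<and> i < width \<pi> 0}"

fun preactivation :: "rnn \<Rightarrow> real vec \<Rightarrow> relu_unit \<Rightarrow> real" where
  "preactivation \<pi> x1 (Hidden t l i) =
     (Wh \<pi> l *\<^sub>v activation \<pi> x1 (t - 1) l + Wx \<pi> l *\<^sub>v activation \<pi> x1 t (l - 1) + vh \<pi> l) $ i"
| "preactivation \<pi> x1 (Output t i) = (Wy \<pi> *\<^sub>v activation \<pi> x1 t (depth \<pi>) + vy \<pi>) $ i"

definition sound_boxes ::
  "rnn \<Rightarrow> nat \<Rightarrow> real vec set \<Rightarrow> (relu_unit \<Rightarrow> real) \<Rightarrow> (relu_unit \<Rightarrow> real) \<Rightarrow> bool" where
  "sound_boxes \<pi> T D lo hi \<longleftrightarrow> (\<forall>u\<in>units \<pi> T.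
     lo u \<le> hi u \<and> (\<forall>x1\<in>D. preactivation \<pi> x1 u \<in> {lo u..hi u}))"

definition score :: "(relu_unit \<Rightarrow> real) \<Rightarrow> (relu_unit \<Rightarrow> real) \<Rightarrow> relu_unit \<Rightarrow> real" where
  "score lo hi u = - lo u * hi u / 2"

definition is_ranking ::
  "rnn \<Rightarrow> nat \<Rightarrow> (relu_unit \<Rightarrow> real) \<Rightarrow> (relu_unit \<Rightarrow> real) \<Rightarrow> relu_unit list \<Rightarrow> bool" where
  "is_ranking \<pi> T lo hi us \<longleftrightarrow>
     distinct us \<and> set us = {u \<in> units \<pi> T. unstable (lo u) (hi u)} \<and>
     sorted_wrt (\<lambda>u v. score lo hi u \<ge> score lo hi v) us"

definition relax_label :: "nat \<Rightarrow> relu_unit list \<Rightarrow> relu_unit \<Rightarrow> nat" where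
  "relax_label Nb us u = (if u \<in> set (drop Nb us) then 1 else 0)"

text \<open>Propagation of the pre-activation set \<open>Z\<close> through a layer whose units are \<open>us\<close>.\<close>

definition relu_layer ::
  "(real \<Rightarrow> real \<Rightarrow> hz) \<Rightarrow> (relu_unit \<Rightarrow> real) \<Rightarrow> (relu_unit \<Rightarrow> real) \<Rightarrow> (relu_unit \<Rightarrow> nat) \<Rightarrow>
   relu_unit list \<Rightarrow> hz \<Rightarrow> hz" where
  "relu_layer G lo hi lab us Z =
     (let m = length us;
          Y = hz_prod (map (\<lambda>u. relaxed_relu G (lo u) (hi u) (lab u)) us)
      in hz_linear (proj_snd m) (hz_inter (proj_fst m) (hz_linear (in_out_perm m) Y) Z))"

text \<open>\<open>layer_hz \<dots> t l\<close> over-approximates the activations of layer \<open>l\<close> at time \<open>t \<ge> 1\<close>; the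
  equation for time 0 is a dummy.\<close>

fun layer_hz ::
  "rnn \<Rightarrow> (real \<Rightarrow> real \<Rightarrow> hz) \<Rightarrow> (relu_unit \<Rightarrow> real) \<Rightarrow> (relu_unit \<Rightarrow> real) \<Rightarrow> (relu_unit \<Rightarrow> nat) \<Rightarrow>
   hz \<Rightarrow> nat \<Rightarrow> nat \<Rightarrow> hz" where
  "layer_hz \<pi> G lo hi lab X 0 l = undefined"
| "layer_hz \<pi> G lo hi lab X (Suc 0) 0 = X"
| "layer_hz \<pi> G lo hi lab X (Suc 0) (Suc l) =
     relu_layer G lo hi lab (map (Hidden (Suc 0) (Suc l)) [0..<width \<pi> (Suc l)])
       (hz_affine (Wx \<pi> (Suc l)) (vh \<pi> (Suc l)) (layer_hz \<pi> G lo hi lab X (Suc 0) l))"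
| "layer_hz \<pi> G lo hi lab X (Suc (Suc t)) 0 =
     relu_layer G lo hi lab (map (Output (Suc t)) [0..<width \<pi> 0])
       (hz_affine (Wy \<pi>) (vy \<pi>) (layer_hz \<pi> G lo hi lab X (Suc t) (depth \<pi>)))"
| "layer_hz \<pi> G lo hi lab X (Suc (Suc t)) (Suc l) =
     relu_layer G lo hi lab (map (Hidden (Suc (Suc t)) (Suc l)) [0..<width \<pi> (Suc l)])
       (hz_affine (Wh \<pi> (Suc l) @\<^sub>c Wx \<pi> (Suc l)) (vh \<pi> (Suc l))
         (constrained_prod (layer_hz \<pi> G lo hi lab X (Suc t) (Suc l))
                           (layer_hz \<pi> G lo hi lab X (Suc (Suc t)) l)))"

text \<open>The boxes and the order among units of equal score are left open by the algorithm, so its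
  output is characterised by a predicate.\<close>

definition relaxed_output ::
  "(real \<Rightarrow> real \<Rightarrow> hz) \<Rightarrow> rnn \<Rightarrow> hz \<Rightarrow> nat \<Rightarrow> nat \<Rightarrow> (nat \<Rightarrow> hz) \<Rightarrow> bool" where
  "relaxed_output G \<pi> X T Nb S \<longleftrightarrow>
     (\<exists>lo hi us. sound_boxes \<pi> T (hz_set X) lo hi \<and> is_ranking \<pi> T lo hi us \<and>
        (\<forall>t\<in>{2..T}. S t =
           constrained_prod (layer_hz \<pi> G lo hi (relax_label Nb us) X 1 0)
                            (layer_hz \<pi> G lo hi (relax_label Nb us) X t 0)))"

definition forward_reach :: "nat \<Rightarrow> (nat \<Rightarrow> hz) \<Rightarrow> hz \<Rightarrow> nat \<Rightarrow> hz" where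
  "forward_reach n S X1 t = hz_linear (proj_snd n) (hz_inter (proj_fst n) (S t) X1)"

definition backward_reach :: "nat \<Rightarrow> (nat \<Rightarrow> hz) \<Rightarrow> hz \<Rightarrow> nat \<Rightarrow> hz" where
  "backward_reach n S U t = hz_linear (proj_fst n) (hz_inter (proj_snd n) (S t) U)"

end

theory Submission
  imports Defs
begin

text \<open>Fix \<open>x\<^sub>1 \<in> X\<close>. The layer sets are built in the order of the computation, and each new set keeps
  the factors of its predecessor as its leading factors. Hence one can choose factors representing
  \<open>x\<^sub>1\<close> and extend them step by step, at every ReLU by the factors of the graph point
  \<open>(s, max s 0)\<close>, where the pre-activation \<open>s\<close> lies in the given interval by soundness of the boxes;
  relaxing a unit only makes more factor values admissible. In the end a single factor vector
  represents all activations, so that \<open>(x\<^sub>1, x\<^sub>t)\<close> lies in \<open>S t\<close>. If \<open>x\<^sub>1 \<in> X1\<close> and \<open>x\<^sub>t \<in> U\<close>, then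
  \<open>x\<^sub>t\<close> is in the forward reachable set and \<open>x\<^sub>1\<close> in the backward one.\<close>

section \<open>Block matrices\<close>

lemma dim_append_cols [simp]:
  "dim_row (A @\<^sub>c B) = dim_row A" "dim_col (A @\<^sub>c B) = dim_col A + dim_col B"
  by (simp_all add: append_cols_def)

lemma dim_append_rows [simp]:
  "dim_row (A @\<^sub>r B) = dim_row A + dim_row B" "dim_col (A @\<^sub>r B) = dim_col A"
  by (simp_all add: append_rows_def)

text \<open>Side conditions here and below are mostly equations between dimensions instead of
  carrier memberships: the simplifier discharges them from the dimension facts that later proofs
  collect as \<open>d\<close>.\<close>

lemma zero_mult_vec [simp]: "dim_vec v = k \<Longrightarrow> 0\<^sub>m r k *\<^sub>v v = (0\<^sub>v r :: real vec)"
  by (rule eq_vecI) auto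

lemma add_zero_vec [simp]:
  "dim_vec v = k \<Longrightarrow> v + 0\<^sub>v k = (v :: real vec)" "dim_vec v = k \<Longrightarrow> 0\<^sub>v k + v = (v :: real vec)"
  by (auto intro!: eq_vecI)

lemma append_cols_mult_vec:
  assumes "dim_row B = dim_row A" "dim_vec a = dim_col A" "dim_vec b = dim_col B"
  shows "(A @\<^sub>c B) *\<^sub>v (a @\<^sub>v b) = A *\<^sub>v a + B *\<^sub>v b"
proof -
  have "(A @\<^sub>c B) *\<^sub>v (a @\<^sub>v b)
      = (A *\<^sub>v a + B *\<^sub>v b) @\<^sub>v (0\<^sub>m 0 (dim_col A) *\<^sub>v a + 0\<^sub>m 0 (dim_col B) *\<^sub>v b)"
    unfolding append_cols_def by (rule four_block_mat_mult_vec) (use assms in \<open>auto intro: carrier_vecI\<close>)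
  also have "\<dots> = A *\<^sub>v a + B *\<^sub>v b"
    by (rule eq_vecI) auto
  finally show ?thesis .
qed

lemma append_rows_mult_vec:
  assumes "dim_col B = dim_col A" "dim_vec v = dim_col A"
  shows "(A @\<^sub>r B) *\<^sub>v v = A *\<^sub>v v @\<^sub>v B *\<^sub>v v"
  by (rule mat_mult_append) (use assms in \<open>auto intro: carrier_vecI\<close>)

text \<open>The block sizes are variables tied by equations, so that the rule still matches once the
  simplifier has rewritten the dimensions inside the zero blocks of
  \<open>block_diag\<close>.\<close>

lemma block_diag_mult_vec:
  fixes A B :: "real mat"
  assumes "dim_row A = r" "dim_col A = k" "dim_row B = s" "dim_col B = l"
    and "dim_vec a = k" "dim_vec b = l"
  shows "four_block_mat A (0\<^sub>m r l) (0\<^sub>m s k) B *\<^sub>v (a @\<^sub>v b) = A *\<^sub>v a @\<^sub>v B *\<^sub>v b"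
proof -
  have "four_block_mat A (0\<^sub>m r l) (0\<^sub>m s k) B *\<^sub>v (a @\<^sub>v b)
      = (A *\<^sub>v a + 0\<^sub>m r l *\<^sub>v b) @\<^sub>v (0\<^sub>m s k *\<^sub>v a + B *\<^sub>v b)"
    by (rule four_block_mat_mult_vec) (use assms in \<open>auto intro: carrier_vecI\<close>)
  then show ?thesis using assms by simp
qed

lemma mult_mult_vec:
  assumes "dim_col A = dim_row B" "dim_vec v = dim_col B"
  shows "(A * B) *\<^sub>v v = A *\<^sub>v (B *\<^sub>v v :: real vec)"
  by (rule assoc_mult_mat_vec) (use assms in \<open>auto intro: carrier_vecI\<close>)

lemma mult_add_vec:
  assumes "dim_vec a = dim_col A" "dim_vec b = dim_col A"
  shows "A *\<^sub>v (a + b :: real vec) = A *\<^sub>v a + A *\<^sub>v b"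
  by (rule mult_add_distrib_mat_vec) (use assms in \<open>auto intro: carrier_vecI\<close>)

lemma mult_zero_vec [simp]: "dim_col A = k \<Longrightarrow> A *\<^sub>v 0\<^sub>v k = (0\<^sub>v (dim_row A) :: real vec)"
  by (rule eq_vecI) auto

lemma append_vec_add_distrib:
  fixes a1 a2 b1 b2 :: "real vec"
  assumes "dim_vec b1 = dim_vec a1" "dim_vec b2 = dim_vec a2"
  shows "(a1 @\<^sub>v a2) + (b1 @\<^sub>v b2) = (a1 + b1) @\<^sub>v (a2 + b2)"
  using assms by (intro eq_vecI) auto

text \<open>Splits the factors read by a larger set into those of a smaller one and a
  remainder.\<close>

lemma vec_add_append: "vec (m + k) f = vec m f @\<^sub>v vec k (\<lambda>i. f (m + i))"
  by (rule eq_vecI) auto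

lemma dim_proj [simp]:
  "dim_row (proj_fst m) = m" "dim_col (proj_fst m) = m + m"
  "dim_row (proj_snd m) = m" "dim_col (proj_snd m) = m + m"
  by (simp_all add: proj_fst_def proj_snd_def)

lemma one_mult_vec: "dim_vec v = m \<Longrightarrow> 1\<^sub>m m *\<^sub>v v = (v :: real vec)"
  by (rule one_mult_mat_vec) auto

lemma proj_mult_append:
  assumes "dim_vec a = m" "dim_vec b = m"
  shows "proj_fst m *\<^sub>v (a @\<^sub>v b) = a" "proj_snd m *\<^sub>v (a @\<^sub>v b) = b"
  using assms by (simp_all add: proj_fst_def proj_snd_def append_cols_mult_vec one_mult_vec)

section \<open>Factors of points of hybrid zonotopes\<close>

text \<open>Exposes the factors that \<open>hz_set\<close> hides behind an existential, since
  sharing them between sets is the point of the argument. The bounds range over the dimensions of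
  the factor vectors, the form to which \<open>all_append_vec\<close> applies.\<close>

definition hz_factors :: "hz \<Rightarrow> real vec \<Rightarrow> real vec \<Rightarrow> real vec \<Rightarrow> bool" where
  "hz_factors Z \<xi>c \<xi>b z \<longleftrightarrow>
     dim_vec \<xi>c = ng Z \<and> (\<forall>i<dim_vec \<xi>c. \<bar>\<xi>c $ i\<bar> \<le> 1) \<and>
     dim_vec \<xi>b = nb Z \<and> (\<forall>i<dim_vec \<xi>b. \<xi>b $ i \<in> {-1, 1}) \<and>
     Ac Z *\<^sub>v \<xi>c + Ab Z *\<^sub>v \<xi>b = rhs Z \<and> z = Gc Z *\<^sub>v \<xi>c + Gb Z *\<^sub>v \<xi>b + cen Z"

lemma mem_carrier_vec_iff: "v \<in> carrier_vec k \<longleftrightarrow> dim_vec v = k"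
  by auto

lemma mem_hz_set_iff: "z \<in> hz_set Z \<longleftrightarrow> (\<exists>\<xi>c \<xi>b. hz_factors Z \<xi>c \<xi>b z)"
  unfolding hz_set_def hz_factors_def mem_carrier_vec_iff mem_Collect_eq
  by (intro ex_cong1) auto

text \<open>Unlike the definition, this form does not make the simplifier loop on
  \<open>Gc Z \<in> carrier_mat n (dim_col (Gc Z))\<close>.\<close>

lemma is_hz_iff:
  "is_hz n Z \<longleftrightarrow> dim_vec (cen Z) = n \<and> dim_row (Gc Z) = n \<and> dim_row (Gb Z) = n \<and>
     dim_row (Ac Z) = nc Z \<and> dim_col (Ac Z) = ng Z \<and> dim_row (Ab Z) = nc Z \<and> dim_col (Ab Z) = nb Z"
proof -
  have mat: "A \<in> carrier_mat r k \<longleftrightarrow> dim_row A = r \<and> dim_col A = k" for A :: "real mat" and r k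
    by auto
  show ?thesis unfolding is_hz_def mat mem_carrier_vec_iff by blast
qed

lemma all_append_vec:
  "(\<forall>i<dim_vec (v @\<^sub>v w). P ((v @\<^sub>v w) $ i)) \<longleftrightarrow>
     (\<forall>i<dim_vec v. P (v $ i)) \<and> (\<forall>i<dim_vec w. P (w $ i))" (is "?L \<longleftrightarrow> ?R")
proof
  assume L: ?L
  have "P (v $ i)" if "i < dim_vec v" for i
    using L[rule_format, of i] that by simp
  moreover have "P (w $ i)" if "i < dim_vec w" for i
    using L[rule_format, of "dim_vec v + i"] that by simp
  ultimately show ?R by blast
qed auto

text \<open>The bounds on factors do not mention the set or the point they belong to, so factors of
  any two points can be concatenated.\<close>

lemma hz_factors_append:
  assumes "\<exists>Z. hz_factors Z \<xi>c \<xi>b z" "\<exists>Y. hz_factors Y \<zeta>c \<zeta>b y"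
  shows "(\<forall>i<dim_vec (\<xi>c @\<^sub>v \<zeta>c). \<bar>(\<xi>c @\<^sub>v \<zeta>c) $ i\<bar> \<le> 1) \<and>
    (\<forall>i<dim_vec (\<xi>b @\<^sub>v \<zeta>b). (\<xi>b @\<^sub>v \<zeta>b) $ i \<in> {-1, 1})"
  using assms unfolding hz_factors_def
    all_append_vec[where P = "\<lambda>x. \<bar>x\<bar> \<le> 1"] all_append_vec[where P = "\<lambda>x. x \<in> {-1, 1}"]
  by blast

lemma hz_factors_dim:
  assumes "hz_factors Z \<xi>c \<xi>b z" "is_hz n Z"
  shows "dim_vec \<xi>c = ng Z" "dim_vec \<xi>b = nb Z" "dim_vec z = n"
  using assms by (auto simp: hz_factors_def is_hz_iff)

lemma dim_hz_set: "z \<in> hz_set Z \<Longrightarrow> is_hz n Z \<Longrightarrow> dim_vec z = n"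
  by (auto simp: mem_hz_set_iff dest: hz_factors_dim(3))

section \<open>Factors under affine maps, generalized intersections and constrained products\<close>

lemma hz_affine_sel [simp]:
  "Gc (hz_affine R v Z) = R * Gc Z" "Gb (hz_affine R v Z) = R * Gb Z"
  "cen (hz_affine R v Z) = R *\<^sub>v cen Z + v" "Ac (hz_affine R v Z) = Ac Z"
  "Ab (hz_affine R v Z) = Ab Z" "rhs (hz_affine R v Z) = rhs Z"
  by (simp_all add: hz_affine_def)

lemma is_hz_affine:
  assumes "is_hz n Z" "dim_row R = m" "dim_vec v = m"
  shows "is_hz m (hz_affine R v Z)"
  using assms unfolding is_hz_iff by simp

text \<open>Serves twice: for affine images, and for the last block row of the constraints of
  \<open>hz_inter\<close>.\<close>

lemma mult_hz_point:
  assumes "hz_factors Z \<xi>c \<xi>b z" "is_hz n Z" "dim_col R = n"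
  shows "R *\<^sub>v z = (R * Gc Z) *\<^sub>v \<xi>c + (R * Gb Z) *\<^sub>v \<xi>b + R *\<^sub>v cen Z"
  using assms unfolding hz_factors_def is_hz_iff by (simp add: mult_mult_vec mult_add_vec)

lemma hz_factors_affine:
  assumes "is_hz n Z" "dim_row R = m" "dim_col R = n" "dim_vec v = m"
    and "hz_factors Z \<xi>c \<xi>b z"
  shows "hz_factors (hz_affine R v Z) \<xi>c \<xi>b (R *\<^sub>v z + v)"
proof -
  have "R *\<^sub>v z + v = (R * Gc Z) *\<^sub>v \<xi>c + (R * Gb Z) *\<^sub>v \<xi>b + (R *\<^sub>v cen Z + v)"
    unfolding mult_hz_point[OF assms(5,1,3)] using assms by (intro eq_vecI) auto
  then show ?thesis
    using assms unfolding hz_factors_def by simp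
qed

lemma is_hz_linear: "is_hz n Z \<Longrightarrow> dim_row R = m \<Longrightarrow> is_hz m (hz_linear R Z)"
  unfolding hz_linear_def by (rule is_hz_affine) auto

lemma hz_factors_linear:
  assumes "is_hz n Z" "dim_col R = n" "hz_factors Z \<xi>c \<xi>b z"
  shows "hz_factors (hz_linear R Z) \<xi>c \<xi>b (R *\<^sub>v z)"
  using hz_factors_affine[OF assms(1) refl assms(2) _ assms(3), of "0\<^sub>v (dim_row R)"]
  by (simp add: hz_linear_def)

lemma hz_inter_sel [simp]:
  "Gc (hz_inter R Z Y) = 0\<^sub>m (dim_row (Gc Z)) (ng Y) @\<^sub>c Gc Z"
  "Gb (hz_inter R Z Y) = 0\<^sub>m (dim_row (Gb Z)) (nb Y) @\<^sub>c Gb Z"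
  "cen (hz_inter R Z Y) = cen Z"
  "Ac (hz_inter R Z Y) = block_diag (Ac Y) (Ac Z) @\<^sub>r (- Gc Y @\<^sub>c R * Gc Z)"
  "Ab (hz_inter R Z Y) = block_diag (Ab Y) (Ab Z) @\<^sub>r (- Gb Y @\<^sub>c R * Gb Z)"
  "rhs (hz_inter R Z Y) = rhs Y @\<^sub>v rhs Z @\<^sub>v (cen Y - R *\<^sub>v cen Z)"
  by (simp_all add: hz_inter_def)

lemma is_hz_inter:
  assumes "is_hz n Z" "is_hz m Y" "dim_row R = m"
  shows "is_hz n (hz_inter R Z Y)"
  using assms unfolding is_hz_iff by simp

text \<open>The upper block rows repeat the constraints of \<open>Y\<close> and \<open>Z\<close>;
  the last one says that both sets of factors yield the same point \<open>R *\<^sub>v z\<close>. The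
  factors of \<open>Y\<close> come first, so that the predecessor in the computation contributes a
  prefix.\<close>

lemma hz_factors_inter:
  assumes Z: "is_hz n Z" and Y: "is_hz m Y" and R: "dim_row R = m" "dim_col R = n"
    and z: "hz_factors Z \<zeta>c \<zeta>b z" and y: "hz_factors Y \<xi>c \<xi>b (R *\<^sub>v z)"
  shows "hz_factors (hz_inter R Z Y) (\<xi>c @\<^sub>v \<zeta>c) (\<xi>b @\<^sub>v \<zeta>b) z"
proof -
  let ?I = "hz_inter R Z Y"
  note d = Z[unfolded is_hz_iff] Y[unfolded is_hz_iff] hz_factors_dim[OF z Z] hz_factors_dim[OF y Y] R
  have z_eq: "z = Gc Z *\<^sub>v \<zeta>c + Gb Z *\<^sub>v \<zeta>b + cen Z"
    and y_eq: "R *\<^sub>v z = Gc Y *\<^sub>v \<xi>c + Gb Y *\<^sub>v \<xi>b + cen Y"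
    and A_eq: "Ac Z *\<^sub>v \<zeta>c + Ab Z *\<^sub>v \<zeta>b = rhs Z" "Ac Y *\<^sub>v \<xi>c + Ab Y *\<^sub>v \<xi>b = rhs Y"
    using y z by (simp_all add: hz_factors_def)
  \<comment> \<open>The shares of the continuous and the binary factors in the last block
    row.\<close>
  let ?C = "- (Gc Y *\<^sub>v \<xi>c) + (R * Gc Z) *\<^sub>v \<zeta>c" and ?B = "- (Gb Y *\<^sub>v \<xi>b) + (R * Gb Z) *\<^sub>v \<zeta>b"
  have link: "?C + ?B = cen Y - R *\<^sub>v cen Z"
  proof (rule eq_vecI)
    fix i assume "i < dim_vec (cen Y - R *\<^sub>v cen Z)"
    then have i: "i < m" using d by simp
    have "(Gc Y *\<^sub>v \<xi>c + Gb Y *\<^sub>v \<xi>b + cen Y) $ i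
        = ((R * Gc Z) *\<^sub>v \<zeta>c + (R * Gb Z) *\<^sub>v \<zeta>b + R *\<^sub>v cen Z) $ i"
      using mult_hz_point[OF z Z R(2)] y_eq by simp
    then show "(?C + ?B) $ i = (cen Y - R *\<^sub>v cen Z) $ i"
      \<comment> \<open>Without this rule the coordinates of matrix-vector products stay atomic, and
        a linear rearrangement remains.\<close>
      using d i by (simp del: index_mult_mat_vec)
  qed (use d in simp)
  have Ac: "Ac ?I *\<^sub>v (\<xi>c @\<^sub>v \<zeta>c) = (Ac Y *\<^sub>v \<xi>c @\<^sub>v Ac Z *\<^sub>v \<zeta>c) @\<^sub>v ?C"
    using d by (simp add: append_rows_mult_vec block_diag_mult_vec append_cols_mult_vec)
  have Ab: "Ab ?I *\<^sub>v (\<xi>b @\<^sub>v \<zeta>b) = (Ab Y *\<^sub>v \<xi>b @\<^sub>v Ab Z *\<^sub>v \<zeta>b) @\<^sub>v ?B"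
    using d by (simp add: append_rows_mult_vec block_diag_mult_vec append_cols_mult_vec)
  have "Ac ?I *\<^sub>v (\<xi>c @\<^sub>v \<zeta>c) + Ab ?I *\<^sub>v (\<xi>b @\<^sub>v \<zeta>b)
      = ((Ac Y *\<^sub>v \<xi>c + Ab Y *\<^sub>v \<xi>b) @\<^sub>v (Ac Z *\<^sub>v \<zeta>c + Ab Z *\<^sub>v \<zeta>b)) @\<^sub>v (?C + ?B)"
    unfolding Ac Ab using d by (simp add: append_vec_add_distrib)
  also have "\<dots> = rhs ?I"
    unfolding link A_eq by (rule eq_vecI) auto
  finally have "Ac ?I *\<^sub>v (\<xi>c @\<^sub>v \<zeta>c) + Ab ?I *\<^sub>v (\<xi>b @\<^sub>v \<zeta>b) = rhs ?I" .
  moreover have "z = Gc ?I *\<^sub>v (\<xi>c @\<^sub>v \<zeta>c) + Gb ?I *\<^sub>v (\<xi>b @\<^sub>v \<zeta>b) + cen ?I"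
    using d by (simp add: append_cols_mult_vec z_eq)
  moreover have "dim_vec (\<xi>c @\<^sub>v \<zeta>c) = ng ?I" "dim_vec (\<xi>b @\<^sub>v \<zeta>b) = nb ?I"
    using d by simp_all
  ultimately show ?thesis
    using hz_factors_append[of \<xi>c \<xi>b _ \<zeta>c \<zeta>b] y z unfolding hz_factors_def[of ?I] by blast
qed

lemma constrained_prod_sel [simp]:
  "Gc (constrained_prod Z Y) = (Gc Z @\<^sub>c 0\<^sub>m (dim_row (Gc Z)) (ng Y - ng Z)) @\<^sub>r Gc Y"
  "Gb (constrained_prod Z Y) = (Gb Z @\<^sub>c 0\<^sub>m (dim_row (Gb Z)) (nb Y - nb Z)) @\<^sub>r Gb Y"
  "cen (constrained_prod Z Y) = cen Z @\<^sub>v cen Y" "Ac (constrained_prod Z Y) = Ac Y"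
  "Ab (constrained_prod Z Y) = Ab Y" "rhs (constrained_prod Z Y) = rhs Y"
  by (simp_all add: constrained_prod_def)

lemma is_hz_constrained_prod:
  assumes "is_hz n Z" "is_hz m Y" "ng Z \<le> ng Y" "nb Z \<le> nb Y"
  shows "is_hz (n + m) (constrained_prod Z Y)"
  using assms unfolding is_hz_iff by simp

text \<open>Sharing is expressed by the factors of \<open>z\<close> being a prefix of those of
  \<open>y\<close>. The zero columns annihilate the additional factors \<open>\<eta>c\<close> and
  \<open>\<eta>b\<close>, and the constraints are those of \<open>Y\<close>.\<close>

lemma hz_factors_constrained_prod:
  assumes Z: "is_hz n Z" and Y: "is_hz m Y"
    and z: "hz_factors Z \<xi>c \<xi>b z" and y: "hz_factors Y (\<xi>c @\<^sub>v \<eta>c) (\<xi>b @\<^sub>v \<eta>b) y"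
  shows "hz_factors (constrained_prod Z Y) (\<xi>c @\<^sub>v \<eta>c) (\<xi>b @\<^sub>v \<eta>b) (z @\<^sub>v y)"
proof -
  let ?C = "constrained_prod Z Y"
  note d = Z[unfolded is_hz_iff] Y[unfolded is_hz_iff] hz_factors_dim[OF z Z]
  \<comment> \<open>Makes the truncated differences in the zero padding equal to the numbers of
    additional factors.\<close>
  have e: "ng Y = ng Z + dim_vec \<eta>c" "nb Y = nb Z + dim_vec \<eta>b"
    using hz_factors_dim[OF y Y] d by simp_all
  have "z = Gc Z *\<^sub>v \<xi>c + Gb Z *\<^sub>v \<xi>b + cen Z"
    and "y = Gc Y *\<^sub>v (\<xi>c @\<^sub>v \<eta>c) + Gb Y *\<^sub>v (\<xi>b @\<^sub>v \<eta>b) + cen Y"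
    using y z by (simp_all add: hz_factors_def)
  then have "z @\<^sub>v y = Gc ?C *\<^sub>v (\<xi>c @\<^sub>v \<eta>c) + Gb ?C *\<^sub>v (\<xi>b @\<^sub>v \<eta>b) + cen ?C"
    using d e by (simp add: append_rows_mult_vec append_cols_mult_vec append_vec_add_distrib)
  moreover have "ng ?C = ng Y" "nb ?C = nb Y"
    using d e by simp_all
  ultimately show ?thesis
    using y unfolding hz_factors_def constrained_prod_sel(4-6) by metis
qed

section \<open>Products of ReLU graphs\<close>

lemma hz_prod_Nil: "is_hz 0 (hz_prod [])" "0\<^sub>v 0 \<in> hz_set (hz_prod [])"
proof -
  show "is_hz 0 (hz_prod [])" by (simp add: is_hz_iff hz_prod_def)
  have "hz_factors (hz_prod []) (0\<^sub>v 0) (0\<^sub>v 0) (0\<^sub>v 0)"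
    by (auto simp: hz_factors_def hz_prod_def intro!: eq_vecI)
  then show "0\<^sub>v 0 \<in> hz_set (hz_prod [])" by (auto simp: mem_hz_set_iff)
qed

lemma hz_prod_Cons_sel:
  "Gc (hz_prod (Z # Zs)) = block_diag (Gc Z) (Gc (hz_prod Zs))"
  "Gb (hz_prod (Z # Zs)) = block_diag (Gb Z) (Gb (hz_prod Zs))"
  "cen (hz_prod (Z # Zs)) = cen Z @\<^sub>v cen (hz_prod Zs)"
  "Ac (hz_prod (Z # Zs)) = block_diag (Ac Z) (Ac (hz_prod Zs))"
  "Ab (hz_prod (Z # Zs)) = block_diag (Ab Z) (Ab (hz_prod Zs))"
  "rhs (hz_prod (Z # Zs)) = rhs Z @\<^sub>v rhs (hz_prod Zs)"
  by (simp_all add: hz_prod_def Let_def)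

lemma hz_prod_Cons:
  assumes Z: "is_hz n Z" and Zs: "is_hz m (hz_prod Zs)"
    and "z \<in> hz_set Z" and "w \<in> hz_set (hz_prod Zs)"
  shows "is_hz (n + m) (hz_prod (Z # Zs))" "z @\<^sub>v w \<in> hz_set (hz_prod (Z # Zs))"
proof -
  let ?W = "hz_prod Zs" and ?P = "hz_prod (Z # Zs)"
  show "is_hz (n + m) ?P"
    using Z Zs unfolding is_hz_iff hz_prod_Cons_sel by simp
  obtain \<xi>c \<xi>b \<zeta>c \<zeta>b where z: "hz_factors Z \<xi>c \<xi>b z" and w: "hz_factors ?W \<zeta>c \<zeta>b w"
    using assms by (auto simp: mem_hz_set_iff)
  note d = Z[unfolded is_hz_iff] Zs[unfolded is_hz_iff] hz_factors_dim[OF z Z] hz_factors_dim[OF w Zs]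
  have eqs: "z = Gc Z *\<^sub>v \<xi>c + Gb Z *\<^sub>v \<xi>b + cen Z" "w = Gc ?W *\<^sub>v \<zeta>c + Gb ?W *\<^sub>v \<zeta>b + cen ?W"
    "Ac Z *\<^sub>v \<xi>c + Ab Z *\<^sub>v \<xi>b = rhs Z" "Ac ?W *\<^sub>v \<zeta>c + Ab ?W *\<^sub>v \<zeta>b = rhs ?W"
    using z w by (simp_all add: hz_factors_def)
  have "z @\<^sub>v w = Gc ?P *\<^sub>v (\<xi>c @\<^sub>v \<zeta>c) + Gb ?P *\<^sub>v (\<xi>b @\<^sub>v \<zeta>b) + cen ?P"
    unfolding hz_prod_Cons_sel eqs(1,2) using d
    by (simp add: block_diag_mult_vec append_vec_add_distrib)
  moreover have "Ac ?P *\<^sub>v (\<xi>c @\<^sub>v \<zeta>c) + Ab ?P *\<^sub>v (\<xi>b @\<^sub>v \<zeta>b) = rhs ?P"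
    unfolding hz_prod_Cons_sel eqs(3,4)[symmetric] using d
    by (simp add: block_diag_mult_vec append_vec_add_distrib)
  moreover have "dim_vec (\<xi>c @\<^sub>v \<zeta>c) = ng ?P" "dim_vec (\<xi>b @\<^sub>v \<zeta>b) = nb ?P"
    using d by (simp_all add: hz_prod_Cons_sel)
  ultimately have "hz_factors ?P (\<xi>c @\<^sub>v \<zeta>c) (\<xi>b @\<^sub>v \<zeta>b) (z @\<^sub>v w)"
    using hz_factors_append[of \<xi>c \<xi>b _ \<zeta>c \<zeta>b] w z unfolding hz_factors_def[of ?P] by blast
  then show "z @\<^sub>v w \<in> hz_set ?P" by (auto simp: mem_hz_set_iff)
qed

lemma hz_prod_map:
  assumes "\<forall>u\<in>set us. is_hz d (F u) \<and> p u \<in> hz_set (F u)"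
  shows "is_hz (d * length us) (hz_prod (map F us)) \<and>
    foldr (@\<^sub>v) (map p us) (0\<^sub>v 0) \<in> hz_set (hz_prod (map F us))"
  using assms
proof (induction us)
  case Nil
  then show ?case using hz_prod_Nil by simp
next
  case (Cons u us)
  then have "is_hz d (F u)" "is_hz (d * length us) (hz_prod (map F us))" "p u \<in> hz_set (F u)"
    "foldr (@\<^sub>v) (map p us) (0\<^sub>v 0) \<in> hz_set (hz_prod (map F us))"
    by simp_all
  from hz_prod_Cons[OF this] show ?case by simp
qed

section \<open>Single ReLU units and their relaxation\<close>

lemma is_hz_relax_binaries: "is_hz n Z \<Longrightarrow> is_hz n (relax_binaries Z)"
  unfolding is_hz_iff relax_binaries_def by simp

text \<open>A sign is an admissible value of a continuous factor, so a point keeps all its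
  factors.\<close>

lemma hz_set_relax_binaries:
  assumes Z: "is_hz n Z"
  shows "hz_set Z \<subseteq> hz_set (relax_binaries Z)"
proof
  fix z assume "z \<in> hz_set Z"
  then obtain \<xi>c \<xi>b where z: "hz_factors Z \<xi>c \<xi>b z" by (auto simp: mem_hz_set_iff)
  note d = Z[unfolded is_hz_iff] hz_factors_dim[OF z Z]
  have "\<forall>i<dim_vec (\<xi>c @\<^sub>v \<xi>b). \<bar>(\<xi>c @\<^sub>v \<xi>b) $ i\<bar> \<le> 1"
    unfolding all_append_vec[where P = "\<lambda>x. \<bar>x\<bar> \<le> 1"] using z by (force simp: hz_factors_def)
  then have "hz_factors (relax_binaries Z) (\<xi>c @\<^sub>v \<xi>b) (0\<^sub>v 0) z"
    using d z unfolding hz_factors_def relax_binaries_def by (simp add: append_cols_mult_vec)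
  then show "z \<in> hz_set (relax_binaries Z)" by (auto simp: mem_hz_set_iff)
qed

text \<open>Valid for every label: an unrelaxed unit represents the graph exactly, a relaxed one
  contains it.\<close>

lemma relaxed_relu_sound:
  assumes "relu_graph_rep G" "\<alpha> \<le> \<beta>" "s \<in> {\<alpha>..\<beta>}"
  shows "is_hz 2 (relaxed_relu G \<alpha> \<beta> lab)"
    and "vec_of_pair (s, max s 0) \<in> hz_set (relaxed_relu G \<alpha> \<beta> lab)"
proof -
  have G: "is_hz 2 (G \<alpha> \<beta>)" "hz_set (G \<alpha> \<beta>) = vec_of_pair ` relu_graph \<alpha> \<beta>"
    using assms by (auto simp: relu_graph_rep_def)
  show "is_hz 2 (relaxed_relu G \<alpha> \<beta> lab)"
    using G is_hz_relax_binaries by (simp add: relaxed_relu_def)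
  have "vec_of_pair (s, max s 0) \<in> hz_set (G \<alpha> \<beta>)"
    using assms(3) unfolding G(2) relu_graph_def by blast
  then show "vec_of_pair (s, max s 0) \<in> hz_set (relaxed_relu G \<alpha> \<beta> lab)"
    using hz_set_relax_binaries[OF G(1)] by (auto simp: relaxed_relu_def)
qed

section \<open>Interleaved graph points and propagation through a whole layer\<close>

lemma vec_of_pair_index [simp]:
  "dim_vec (vec_of_pair p) = 2" "vec_of_pair p $ 0 = fst p" "vec_of_pair p $ Suc 0 = snd p"
  by (simp_all add: vec_of_pair_def)

lemma dim_foldr_pairs: "dim_vec (foldr (@\<^sub>v) (map (\<lambda>u. vec_of_pair (p u)) us) vNil) = 2 * length us"
  by (induction us) auto

lemma index_foldr_pairs:
  assumes "i < length us"
  shows "foldr (@\<^sub>v) (map (\<lambda>u. vec_of_pair (p u)) us) vNil $ (2 * i) = fst (p (us ! i))"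
    and "foldr (@\<^sub>v) (map (\<lambda>u. vec_of_pair (p u)) us) vNil $ Suc (2 * i) = snd (p (us ! i))"
  using assms
  by (induction us arbitrary: i) (auto simp: nth_Cons dim_foldr_pairs split: nat.splits)

lemma in_out_perm_mult_vec:
  assumes "dim_vec v = 2 * m"
  shows "in_out_perm m *\<^sub>v v = vec m (\<lambda>i. v $ (2 * i)) @\<^sub>v vec m (\<lambda>i. v $ Suc (2 * i))"
proof (rule eq_vecI)
  fix i assume "i < dim_vec (vec m (\<lambda>i. v $ (2 * i)) @\<^sub>v vec m (\<lambda>i. v $ Suc (2 * i)))"
  then have i: "i < 2 * m" by simp
  \<comment> \<open>The column of the only nonzero entry in row \<open>i\<close>.\<close>
  define k where "k = (if i < m then 2 * i else 2 * (i - m) + 1)"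
  have k: "k < 2 * m" using i by (auto simp: k_def)
  have "(in_out_perm m *\<^sub>v v) $ i = (\<Sum>j<2 * m. (if j = k then 1 else 0) * v $ j)"
    using i assms by (simp add: in_out_perm_def scalar_prod_def k_def lessThan_atLeast0)
  also have "\<dots> = (\<Sum>j<2 * m. if j = k then v $ j else 0)"
    by (rule sum.cong) auto
  also have "\<dots> = v $ k"
    using k by simp
  finally show "(in_out_perm m *\<^sub>v v) $ i
      = (vec m (\<lambda>i. v $ (2 * i)) @\<^sub>v vec m (\<lambda>i. v $ Suc (2 * i))) $ i"
    using i by (auto simp: k_def)
qed (simp add: in_out_perm_def)

text \<open>The graph points over the coordinates of \<open>z\<close> form a point of the product,
  which the permutation turns into \<open>z @\<^sub>v relu z\<close>. Its first half is the given
  point of \<open>Z\<close>, so the intersection retains it, with the factors of \<open>z\<close> in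
  front, and the projection reads off \<open>relu z\<close>.\<close>

lemma relu_layer_factors:
  assumes G: "relu_graph_rep G" and Z: "is_hz m Z" and m: "length us = m"
    and z: "hz_factors Z \<xi>c \<xi>b z" and box: "\<forall>i<m. z $ i \<in> {lo (us ! i)..hi (us ! i)}"
  shows "is_hz m (relu_layer G lo hi lab us Z) \<and>
    (\<exists>\<zeta>c \<zeta>b. hz_factors (relu_layer G lo hi lab us Z) (\<xi>c @\<^sub>v \<zeta>c) (\<xi>b @\<^sub>v \<zeta>b) (relu z))"
proof -
  \<comment> \<open>Indexed by positions in \<open>us\<close>, not by units, because the graph point
    \<open>p i\<close> depends on coordinate \<open>i\<close> of \<open>z\<close>.\<close>
  define F where "F i = relaxed_relu G (lo (us ! i)) (hi (us ! i)) (lab (us ! i))" for i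
  define p where "p i = (z $ i, max (z $ i) 0)" for i
  define v where "v = foldr (@\<^sub>v) (map (\<lambda>i. vec_of_pair (p i)) [0..<m]) (0\<^sub>v 0)"
  have dz: "dim_vec z = m" by (rule hz_factors_dim(3)[OF z Z])
  have "map (\<lambda>u. relaxed_relu G (lo u) (hi u) (lab u)) us = map F [0..<m]"
    by (rule nth_equalityI) (auto simp: F_def m)
  then have L: "relu_layer G lo hi lab us Z = hz_linear (proj_snd m)
      (hz_inter (proj_fst m) (hz_linear (in_out_perm m) (hz_prod (map F [0..<m]))) Z)"
    by (simp add: relu_layer_def Let_def m)
  have "is_hz 2 (F i) \<and> vec_of_pair (p i) \<in> hz_set (F i)" if "i < m" for i
  proof -
    \<comment> \<open>The interval is nonempty because it contains \<open>z $ i\<close>;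
      \<open>relu_graph_rep\<close> speaks only of such intervals.\<close>
    have "lo (us ! i) \<le> hi (us ! i)" "z $ i \<in> {lo (us ! i)..hi (us ! i)}"
      using box that by force+
    then show ?thesis
      using relaxed_relu_sound[OF G] by (simp add: F_def p_def)
  qed
  then have "is_hz (2 * m) (hz_prod (map F [0..<m])) \<and> v \<in> hz_set (hz_prod (map F [0..<m]))"
    using hz_prod_map[of "[0..<m]" 2 F "\<lambda>i. vec_of_pair (p i)"] by (simp add: v_def)
  then obtain \<zeta>c \<zeta>b where Y: "is_hz (2 * m) (hz_prod (map F [0..<m]))"
    and v: "hz_factors (hz_prod (map F [0..<m])) \<zeta>c \<zeta>b v"
    by (auto simp: mem_hz_set_iff)
  have "in_out_perm m *\<^sub>v v = vec m (\<lambda>i. v $ (2 * i)) @\<^sub>v vec m (\<lambda>i. v $ Suc (2 * i))"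
    by (rule in_out_perm_mult_vec) (simp add: v_def dim_foldr_pairs)
  also have "\<dots> = z @\<^sub>v relu z"
    using dz by (intro eq_vecI) (auto simp: v_def index_foldr_pairs p_def relu_def)
  finally have perm: "in_out_perm m *\<^sub>v v = z @\<^sub>v relu z" .
  let ?P = "hz_linear (in_out_perm m) (hz_prod (map F [0..<m]))"
  have dP: "dim_row (in_out_perm m) = m + m" "dim_col (in_out_perm m) = 2 * m"
    by (simp_all add: in_out_perm_def)
  have P: "is_hz (m + m) ?P" by (rule is_hz_linear[OF Y dP(1)])
  have "hz_factors ?P \<zeta>c \<zeta>b (z @\<^sub>v relu z)"
    using hz_factors_linear[OF Y dP(2) v] by (simp add: perm)
  then have "hz_factors (hz_inter (proj_fst m) ?P Z) (\<xi>c @\<^sub>v \<zeta>c) (\<xi>b @\<^sub>v \<zeta>b) (z @\<^sub>v relu z)"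
    \<comment> \<open>The rotation brings the premise on the permuted product to the front, where
      the chained fact is consumed.\<close>
    by (rule hz_factors_inter[OF P Z, rotated 2]) (simp_all add: proj_mult_append dz relu_def z)
  moreover have I: "is_hz (m + m) (hz_inter (proj_fst m) ?P Z)"
    by (rule is_hz_inter[OF P Z]) simp
  ultimately have "hz_factors (relu_layer G lo hi lab us Z) (\<xi>c @\<^sub>v \<zeta>c) (\<xi>b @\<^sub>v \<zeta>b)
      (proj_snd m *\<^sub>v (z @\<^sub>v relu z))"
    unfolding L by (intro hz_factors_linear) auto
  moreover have "proj_snd m *\<^sub>v (z @\<^sub>v relu z) = relu z"
    by (simp add: proj_mult_append dz relu_def)
  ultimately show ?thesis
    using is_hz_linear[OF I, of "proj_snd m" m] unfolding L by auto
qed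

section \<open>Soundness of the relaxed algorithm\<close>

text \<open>A single pair of factor sequences serves all sets at once: each set reads off an initial
  segment, which is the sharing that \<open>constrained_prod\<close> presupposes.\<close>

definition generated_by :: "(nat \<Rightarrow> real) \<Rightarrow> (nat \<Rightarrow> real) \<Rightarrow> hz \<Rightarrow> real vec \<Rightarrow> bool" where
  "generated_by f g Z z \<longleftrightarrow> hz_factors Z (vec (ng Z) f) (vec (nb Z) g) z"

text \<open>Permits changing the sequences beyond the segment that a set reads.\<close>

lemma generated_by_cong:
  assumes "\<forall>i<ng Z. f i = f' i" "\<forall>i<nb Z. g i = g' i"
  shows "generated_by f g Z z = generated_by f' g' Z z"
proof -
  have "vec (ng Z) f = vec (ng Z) f'" "vec (nb Z) g = vec (nb Z) g'"
    using assms by (auto intro!: eq_vecI)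
  then show ?thesis by (simp add: generated_by_def)
qed

lemma generated_by_mem: "generated_by f g Z z \<Longrightarrow> z \<in> hz_set Z"
  by (auto simp: generated_by_def mem_hz_set_iff)

lemma generated_by_dim: "generated_by f g Z z \<Longrightarrow> is_hz n Z \<Longrightarrow> dim_vec z = n"
  by (rule dim_hz_set[OF generated_by_mem])

lemma generated_by_affine:
  assumes "is_hz n Z" "dim_row R = m" "dim_col R = n" "dim_vec v = m" "generated_by f g Z z"
  shows "generated_by f g (hz_affine R v Z) (R *\<^sub>v z + v)"
  using hz_factors_affine[OF assms(1-4)] assms(5) by (simp add: generated_by_def)

text \<open>Initial segments of the same sequences are prefixes of one another, as
  \<open>hz_factors_constrained_prod\<close> demands.\<close>

lemma generated_by_constrained_prod:
  assumes "is_hz n Z" "is_hz m Y" "ng Z \<le> ng Y" "nb Z \<le> nb Y"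
    and "generated_by f g Z z" "generated_by f g Y y"
  shows "generated_by f g (constrained_prod Z Y) (z @\<^sub>v y)"
proof -
  obtain k k' where k: "ng Y = ng Z + k" "nb Y = nb Z + k'"
    using assms(3,4) by (metis le_iff_add)
  show ?thesis
    using hz_factors_constrained_prod[OF assms(1,2)] assms(5,6) k
    by (simp add: generated_by_def vec_add_append)
qed

text \<open>The factors of the new graph points are written into the sequences directly behind those
  read by \<open>Z\<close>.\<close>

lemma generated_by_relu_layer:
  fixes lab :: "relu_unit \<Rightarrow> nat"
  assumes "relu_graph_rep G" "is_hz m Z" "length us = m" "generated_by f g Z z"
    and "\<forall>i<m. z $ i \<in> {lo (us ! i)..hi (us ! i)}"
  defines "L \<equiv> relu_layer G lo hi lab us Z"
  obtains f' g' where "\<forall>i<ng Z. f i = f' i" "\<forall>i<nb Z. g i = g' i" "generated_by f' g' L (relu z)"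
    "ng Z \<le> ng L" "nb Z \<le> nb L" "is_hz m L"
proof -
  obtain \<zeta>c \<zeta>b where L: "is_hz m L"
    and fac: "hz_factors L (vec (ng Z) f @\<^sub>v \<zeta>c) (vec (nb Z) g @\<^sub>v \<zeta>b) (relu z)"
    using relu_layer_factors[OF assms(1-3) _ assms(5)] assms(4)
    unfolding L_def generated_by_def by blast
  have d: "ng L = ng Z + dim_vec \<zeta>c" "nb L = nb Z + dim_vec \<zeta>b"
    using hz_factors_dim[OF fac L] by simp_all
  define f' where "f' i = (if i < ng Z then f i else \<zeta>c $ (i - ng Z))" for i
  define g' where "g' i = (if i < nb Z then g i else \<zeta>b $ (i - nb Z))" for i
  have "vec (ng L) f' = vec (ng Z) f @\<^sub>v \<zeta>c" "vec (nb L) g' = vec (nb Z) g @\<^sub>v \<zeta>b"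
    by (auto intro!: eq_vecI simp: d f'_def g'_def)
  then have "generated_by f' g' L (relu z)"
    using fac by (simp add: generated_by_def)
  moreover have "\<forall>i<ng Z. f i = f' i" "\<forall>i<nb Z. g i = g' i"
    by (simp_all add: f'_def g'_def)
  moreover have "ng Z \<le> ng L" "nb Z \<le> nb L"
    using d by simp_all
  ultimately show thesis
    using that L by blast
qed

text \<open>The invariant of the run: \<open>P\<close> holds the positions computed so far and
  \<open>q\<close> the latest one. No set reads more factors than \<open>H q\<close>, so whatever
  lies beyond those is free for later layers.\<close>

definition jointly_generated ::
  "('p \<Rightarrow> nat) \<Rightarrow> ('p \<Rightarrow> hz) \<Rightarrow> ('p \<Rightarrow> real vec) \<Rightarrow> 'p set \<Rightarrow> 'p \<Rightarrow> (nat \<Rightarrow> real) \<Rightarrow> (nat \<Rightarrow> real) \<Rightarrow> bool" where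
  "jointly_generated w H a P q f g \<longleftrightarrow> (\<forall>p\<in>P. is_hz (w p) (H p) \<and>
     ng (H p) \<le> ng (H q) \<and> nb (H p) \<le> nb (H q) \<and> generated_by f g (H p) (a p))"

text \<open>Here \<open>Z\<close> is the pre-activation set, which has exactly as many factors as
  \<open>H q\<close>. The extension therefore starts behind every factor in use, and the earlier
  sets remain generated.\<close>

lemma jointly_generated_relu_layer:
  assumes J: "jointly_generated w H a P q f g"
    and G: "relu_graph_rep G" and Z: "is_hz (w r) Z" "ng Z = ng (H q)" "nb Z = nb (H q)"
    and us: "length us = w r" and z: "generated_by f g Z z"
    and box: "\<forall>i<w r. z $ i \<in> {lo (us ! i)..hi (us ! i)}"
    and H: "H r = relu_layer G lo hi lab us Z" and a: "a r = relu z"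
  shows "\<exists>f' g'. jointly_generated w H a (insert r P) r f' g'"
proof -
  obtain f' g' where ext: "\<forall>i<ng Z. f i = f' i" "\<forall>i<nb Z. g i = g' i"
    and new: "generated_by f' g' (H r) (a r)" "ng Z \<le> ng (H r)" "nb Z \<le> nb (H r)" "is_hz (w r) (H r)"
    using generated_by_relu_layer[OF G Z(1) us z box, where lab = lab] unfolding H a by blast
  have "generated_by f' g' (H p) (a p)" if "p \<in> P" for p
    using J that ext generated_by_cong[of "H p" f f' g g'] Z
    by (force simp: jointly_generated_def)
  then have "jointly_generated w H a (insert r P) r f' g'"
    using J new Z by (force simp: jointly_generated_def)
  then show ?thesis by blast
qed

text \<open>What has been computed once \<open>(t, l)\<close> is done, in lexicographic order. Time
  0 is excluded, where \<open>layer_hz\<close> is a dummy.\<close>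

definition positions :: "nat \<Rightarrow> nat \<Rightarrow> nat \<Rightarrow> (nat \<times> nat) set" where
  "positions D t l = {(t', l'). 1 \<le> t' \<and> l' \<le> D \<and> (t' < t \<or> t' = t \<and> l' \<le> l)}"

text \<open>Follows the run: \<open>hidden\<close> and \<open>recurrence\<close> are its single
  steps, \<open>layers\<close> the inner and \<open>times\<close> the outer loop. At time
  \<open>T\<close> only layer 0 is covered, since \<open>units\<close> ends at
  \<open>T - 1\<close>.\<close>

lemma layer_hz_jointly_generated:
  fixes \<pi> G lo hi lab X x1
  defines "H \<equiv> \<lambda>(t, l). layer_hz \<pi> G lo hi lab X t l"
    and "a \<equiv> \<lambda>(t, l). activation \<pi> x1 t l" and "w \<equiv> \<lambda>(t :: nat, l). width \<pi> l"
  assumes rnn: "is_rnn n \<pi>" and X: "is_hz n X" and x1: "x1 \<in> hz_set X"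
    and G: "relu_graph_rep G" and box: "sound_boxes \<pi> T (hz_set X) lo hi"
    and tl: "1 \<le> t" "t \<le> T" "l \<le> depth \<pi>" "l = 0 \<or> t < T"
  shows "\<exists>f g. jointly_generated w H a (positions (depth \<pi>) t l) (t, l) f g"
proof -
  let ?D = "depth \<pi>"
  let ?J = "\<lambda>t l f g. jointly_generated w H a (positions ?D t l) (t, l) f g"
  have W: "dim_row (Wh \<pi> l) = width \<pi> l" "dim_col (Wh \<pi> l) = width \<pi> l"
    "dim_row (Wx \<pi> l) = width \<pi> l" "dim_col (Wx \<pi> l) = width \<pi> (l - 1)"
    "dim_vec (vh \<pi> l) = width \<pi> l" if "1 \<le> l" "l \<le> ?D" for l
    using rnn that by (auto simp: is_rnn_def)
  have Wy: "dim_row (Wy \<pi>) = n" "dim_col (Wy \<pi>) = width \<pi> ?D" "dim_vec (vy \<pi>) = n"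
    and w0: "width \<pi> 0 = n"
    using rnn by (auto simp: is_rnn_def)
  have unit: "preactivation \<pi> x1 u \<in> {lo u..hi u}" if "u \<in> units \<pi> T" for u
    using box x1 that by (auto simp: sound_boxes_def)
  have start: "\<exists>f g. ?J 1 0 f g"
  proof -
    obtain \<xi>c \<xi>b where x: "hz_factors X \<xi>c \<xi>b x1"
      using x1 by (auto simp: mem_hz_set_iff)
    \<comment> \<open>The coordinate functions of the factors of \<open>x1\<close> serve as the
      first sequences.\<close>
    have "vec (ng X) (($) \<xi>c) = \<xi>c" "vec (nb X) (($) \<xi>b) = \<xi>b"
      using hz_factors_dim[OF x X] by (auto intro!: eq_vecI)
    then have "generated_by (($) \<xi>c) (($) \<xi>b) X x1"
      using x by (simp add: generated_by_def)
    then have "?J 1 0 (($) \<xi>c) (($) \<xi>b)"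
      using X by (auto simp: jointly_generated_def positions_def H_def a_def w_def w0)
    then show ?thesis by blast
  qed
  have hidden: "\<exists>f g. ?J t (Suc l) f g"
    if J: "\<exists>f g. ?J t l f g" and tl: "1 \<le> t" "t < T" "Suc l \<le> ?D" for t l
  proof -
    obtain f g where J: "?J t l f g" using J by blast
    define h where "h = activation \<pi> x1 (t - 1) (Suc l)"
    define y where "y = activation \<pi> x1 t l"
    define z where "z = Wh \<pi> (Suc l) *\<^sub>v h + Wx \<pi> (Suc l) *\<^sub>v y + vh \<pi> (Suc l)"
    define us where "us = map (Hidden t (Suc l)) [0..<width \<pi> (Suc l)]"
    note W = W[of "Suc l", simplified, OF tl(3)]
    have y: "is_hz (width \<pi> l) (H (t, l))" "generated_by f g (H (t, l)) y"
      using J tl by (auto simp: jointly_generated_def positions_def a_def w_def y_def)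
    note dy = generated_by_dim[OF y(2,1)]
    have "\<exists>Z. is_hz (width \<pi> (Suc l)) Z \<and> ng Z = ng (H (t, l)) \<and> nb Z = nb (H (t, l)) \<and>
        generated_by f g Z z \<and> H (t, Suc l) = relu_layer G lo hi lab us Z"
    proof (cases "t = 1")
      case True
      let ?Z = "hz_affine (Wx \<pi> (Suc l)) (vh \<pi> (Suc l)) (H (t, l))"
      \<comment> \<open>The hidden state at time 0 is zero, which removes the term with
        \<open>Wh\<close>.\<close>
      have "z = Wx \<pi> (Suc l) *\<^sub>v y + vh \<pi> (Suc l)"
        using True W dy by (simp add: z_def h_def)
      then have "generated_by f g ?Z z"
        using generated_by_affine[OF y(1) _ _ _ y(2)] W by simp
      moreover have "is_hz (width \<pi> (Suc l)) ?Z"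
        using is_hz_affine[OF y(1)] W by simp
      moreover have "H (t, Suc l) = relu_layer G lo hi lab us ?Z"
        using True by (simp add: H_def us_def)
      ultimately show ?thesis by (intro exI[of _ ?Z]) simp
    next
      case False
      then obtain s where s: "t = Suc (Suc s)"
        using tl(1) by (metis One_nat_def Suc_le_D not0_implies_Suc)
      let ?P = "H (Suc s, Suc l)" and ?R = "Wh \<pi> (Suc l) @\<^sub>c Wx \<pi> (Suc l)"
      let ?C = "constrained_prod ?P (H (t, l))"
      let ?Z = "hz_affine ?R (vh \<pi> (Suc l)) ?C"
      \<comment> \<open>The same layer one time step earlier is already among the computed
        positions. Hence \<open>J\<close> provides its generation by the same \<open>f\<close> and
        \<open>g\<close> and the inequalities that the constrained product requires.\<close>
      have "(Suc s, Suc l) \<in> positions ?D t l"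
        using tl s by (simp add: positions_def)
      note P = bspec[OF J[unfolded jointly_generated_def] this]
      have P: "is_hz (width \<pi> (Suc l)) ?P" "generated_by f g ?P h"
        "ng ?P \<le> ng (H (t, l))" "nb ?P \<le> nb (H (t, l))"
        using P by (simp_all add: a_def w_def h_def s)
      note dh = generated_by_dim[OF P(2,1)]
      have C: "is_hz (width \<pi> (Suc l) + width \<pi> l) ?C" "generated_by f g ?C (h @\<^sub>v y)"
        using is_hz_constrained_prod[OF P(1) y(1) P(3,4)]
          generated_by_constrained_prod[OF P(1) y(1) P(3,4,2) y(2)] by auto
      have "z = ?R *\<^sub>v (h @\<^sub>v y) + vh \<pi> (Suc l)"
        using W dh dy by (simp add: z_def append_cols_mult_vec)
      then have "generated_by f g ?Z z"
        using generated_by_affine[OF C(1) _ _ _ C(2)] W by simp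
      moreover have "is_hz (width \<pi> (Suc l)) ?Z"
        using is_hz_affine[OF C(1)] W by simp
      moreover have "H (t, Suc l) = relu_layer G lo hi lab us ?Z"
        using s by (simp add: H_def us_def)
      ultimately show ?thesis
        using P by (intro exI[of _ ?Z]) simp
    qed
    then obtain Z where Z: "is_hz (w (t, Suc l)) Z" "ng Z = ng (H (t, l))" "nb Z = nb (H (t, l))"
      "generated_by f g Z z" "H (t, Suc l) = relu_layer G lo hi lab us Z"
      by (auto simp: w_def)
    \<comment> \<open>By \<open>t < T\<close> this is one of the units for which the boxes are
      sound.\<close>
    have "z $ i \<in> {lo (us ! i)..hi (us ! i)}" if "i < w (t, Suc l)" for i
      using unit[of "Hidden t (Suc l) i"] that tl
      by (simp add: units_def w_def us_def z_def h_def y_def)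
    moreover have "a (t, Suc l) = relu z"
      using tl by (cases t) (auto simp: a_def z_def h_def y_def)
    moreover have "length us = w (t, Suc l)" by (simp add: us_def w_def)
    ultimately have "\<exists>f' g'. jointly_generated w H a (insert (t, Suc l) (positions ?D t l)) (t, Suc l) f' g'"
      using Z by (intro jointly_generated_relu_layer[OF J G]) auto
    moreover have "insert (t, Suc l) (positions ?D t l) = positions ?D t (Suc l)"
      using tl by (auto simp: positions_def)
    ultimately show ?thesis by simp
  qed
  have recurrence: "\<exists>f g. ?J (Suc t) 0 f g" if J: "\<exists>f g. ?J t ?D f g" and t: "1 \<le> t" "t < T" for t
  proof -
    obtain f g where J: "?J t ?D f g" using J by blast
    define y where "y = activation \<pi> x1 t ?D"
    define z where "z = Wy \<pi> *\<^sub>v y + vy \<pi>"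
    define us where "us = map (Output t) [0..<width \<pi> 0]"
    obtain s where s: "t = Suc s" using t by (cases t) auto
    let ?Z = "hz_affine (Wy \<pi>) (vy \<pi>) (H (t, ?D))"
    have y: "is_hz (width \<pi> ?D) (H (t, ?D))" "generated_by f g (H (t, ?D)) y"
      using J t by (auto simp: jointly_generated_def positions_def a_def w_def y_def)
    have Z: "generated_by f g ?Z z" "is_hz (w (Suc t, 0)) ?Z"
      using generated_by_affine[OF y(1) _ _ _ y(2)] is_hz_affine[OF y(1)] Wy
      by (simp_all add: z_def w_def w0)
    have "z $ i \<in> {lo (us ! i)..hi (us ! i)}" if "i < w (Suc t, 0)" for i
      using unit[of "Output t i"] that t by (simp add: units_def w_def us_def z_def y_def)
    moreover have "a (Suc t, 0) = relu z"
      by (simp add: a_def z_def y_def s)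
    moreover have "length us = w (Suc t, 0)" by (simp add: us_def w_def)
    moreover have "H (Suc t, 0) = relu_layer G lo hi lab us ?Z"
      by (simp add: H_def us_def s)
    ultimately have "\<exists>f' g'. jointly_generated w H a (insert (Suc t, 0) (positions ?D t ?D)) (Suc t, 0) f' g'"
      using Z by (intro jointly_generated_relu_layer[OF J G, where Z = ?Z]) auto
    \<comment> \<open>The state at the next time directly follows the last hidden layer.\<close>
    moreover have "insert (Suc t, 0) (positions ?D t ?D) = positions ?D (Suc t) 0"
      using t by (auto simp: positions_def less_Suc_eq)
    ultimately show ?thesis by simp
  qed
  have layers: "\<exists>f g. ?J t l f g"
    if "\<exists>f g. ?J t 0 f g" "1 \<le> t" "t < T" "l \<le> ?D" for t l
    using that(4) by (induction l) (use that hidden in auto)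
  have times: "\<exists>f g. ?J t 0 f g" if "1 \<le> t" "t \<le> T" for t
    using that
  proof (induction t rule: dec_induct)
    case base
    show ?case by (rule start)
  next
    case (step t)
    then show ?case using recurrence[of t] layers[of t ?D] by simp
  qed
  show ?thesis
    using tl times[of t] layers[of t l] by auto
qed

text \<open>The same sequences generate \<open>x1\<close> and the state at time \<open>t\<close>, so
  the constrained product contains the pair itself and not merely each component separately.\<close>

lemma relaxed_output_sound:
  assumes rnn: "is_rnn n \<pi>" and X: "is_hz n X" and G: "relu_graph_rep G"
    and S: "relaxed_output G \<pi> X T Nb S" and x1: "x1 \<in> hz_set X" and t: "t \<in> {2..T}"
  shows "is_hz (n + n) (S t)" and "x1 @\<^sub>v trajectory \<pi> x1 t \<in> hz_set (S t)"
    and "dim_vec (trajectory \<pi> x1 t) = n"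
proof -
  obtain lo hi us where box: "sound_boxes \<pi> T (hz_set X) lo hi"
    and St: "S t = constrained_prod (layer_hz \<pi> G lo hi (relax_label Nb us) X 1 0)
                            (layer_hz \<pi> G lo hi (relax_label Nb us) X t 0)"
    using S t unfolding relaxed_output_def by blast
  let ?H = "layer_hz \<pi> G lo hi (relax_label Nb us) X"
  have w0: "width \<pi> 0 = n" using rnn by (simp add: is_rnn_def)
  obtain f g where J: "jointly_generated (\<lambda>(t, l). width \<pi> l) (\<lambda>(t, l). ?H t l)
      (\<lambda>(t, l). activation \<pi> x1 t l) (positions (depth \<pi>) t 0) (t, 0) f g"
    using layer_hz_jointly_generated[OF rnn X x1 G box, of t 0 "relax_label Nb us"] t by auto
  have "(1, 0) \<in> positions (depth \<pi>) t 0" "(t, 0) \<in> positions (depth \<pi>) t 0"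
    using t by (auto simp: positions_def)
  then have A: "generated_by f g (?H 1 0) x1" "is_hz n (?H 1 0)"
    "ng (?H 1 0) \<le> ng (?H t 0)" "nb (?H 1 0) \<le> nb (?H t 0)"
    and B: "generated_by f g (?H t 0) (trajectory \<pi> x1 t)" "is_hz n (?H t 0)"
    using J by (force simp: jointly_generated_def w0 trajectory_def)+
  show "is_hz (n + n) (S t)"
    unfolding St by (rule is_hz_constrained_prod[OF A(2) B(2) A(3,4)])
  show "x1 @\<^sub>v trajectory \<pi> x1 t \<in> hz_set (S t)"
    unfolding St by (rule generated_by_mem[OF generated_by_constrained_prod[OF A(2) B(2) A(3,4,1) B(1)]])
  show "dim_vec (trajectory \<pi> x1 t) = n"
    by (rule generated_by_dim[OF B])
qed

text \<open>Covers both reachable sets; they differ in which projection is \<open>R\<close> and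
  which is \<open>Q\<close>.\<close>

lemma hz_linear_inter_mem:
  assumes "is_hz n Z" "is_hz m Y" "dim_row R = m" "dim_col R = n" "dim_col Q = n"
    and "z \<in> hz_set Z" "R *\<^sub>v z \<in> hz_set Y"
  shows "Q *\<^sub>v z \<in> hz_set (hz_linear Q (hz_inter R Z Y))"
  using assms hz_factors_inter[OF assms(1-4)] hz_factors_linear[OF is_hz_inter[OF assms(1-3)] assms(5)]
  unfolding mem_hz_set_iff by blast

theorem proposition3:
  fixes n T Nb :: nat and \<pi> :: rnn and X X1 U :: hz
    and G :: "real \<Rightarrow> real \<Rightarrow> hz" and S :: "nat \<Rightarrow> hz"
  assumes "is_rnn n \<pi>" and "T > 1"
    and "is_hz n X" and "is_hz n X1" and "is_hz n U"
    and "hz_set X1 \<subseteq> hz_set X" and "hz_set U \<subseteq> hz_set X"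
    and "hz_set X1 \<inter> hz_set U = {}"
    and "relu_graph_rep G"
    and "relaxed_output G \<pi> X T Nb S"
    and "(\<forall>t\<in>{2..T}. hz_set (forward_reach n S X1 t) \<inter> hz_set U = {}) \<or>
         (\<forall>t\<in>{2..T}. hz_set (backward_reach n S U t) \<inter> hz_set X1 = {})"
  shows "\<forall>x1\<in>hz_set X1. \<forall>t\<in>{1..T}. trajectory \<pi> x1 t \<notin> hz_set U"
proof (intro ballI notI)
  fix x1 t assume x1: "x1 \<in> hz_set X1" and t: "t \<in> {1..T}" and xt: "trajectory \<pi> x1 t \<in> hz_set U"
  show False
  proof (cases "t = 1")
    case True
    \<comment> \<open>The algorithm outputs no set for time 1; disjointness of the initial and the
      unsafe set settles it.\<close>
    then show False using x1 xt assms(8) by (auto simp: trajectory_def)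
  next
    case False
    then have t: "t \<in> {2..T}" using t by auto
    let ?z = "x1 @\<^sub>v trajectory \<pi> x1 t"
    have "x1 \<in> hz_set X" using x1 assms(6) by auto
    note S = relaxed_output_sound[OF assms(1,3,9,10) this t]
    have p: "proj_fst n *\<^sub>v ?z = x1" "proj_snd n *\<^sub>v ?z = trajectory \<pi> x1 t"
      using dim_hz_set[OF x1 assms(4)] S(3) by (simp_all add: proj_mult_append)
    have "proj_snd n *\<^sub>v ?z \<in> hz_set (forward_reach n S X1 t)"
      unfolding forward_reach_def
      by (rule hz_linear_inter_mem[OF S(1) assms(4) _ _ _ S(2)]) (simp_all add: p x1)
    moreover have "proj_fst n *\<^sub>v ?z \<in> hz_set (backward_reach n S U t)"
      unfolding backward_reach_def
      by (rule hz_linear_inter_mem[OF S(1) assms(5) _ _ _ S(2)]) (simp_all add: p xt)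
    \<comment> \<open>Each alternative of the last assumption contradicts one of the two
      memberships.\<close>
    ultimately show False
      using assms(11) t x1 xt unfolding p by blast
  qed
qed

end
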